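(* Let $\psi:\mathcal X\times\mathcal Y\to\mathbb R$ be given by a $\mathcal K$-representation $$\psi(x,y)=\inf_{f,t,u}\{f^Ty+t: Pf+tp+Qu+Rx\leq_{\mathbf K}s\}\quad\forall x\in\mathcal X,\ y\in\mathcal Y\qquad[\mathbf K\in\mathcal K].$$ Then for all $(\alpha,x)$ with $\alpha>0$, $\alpha^{-1}x\in\mathcal X$, and all $y\in\mathcal Y$, the function $\overline\psi((\alpha,x),y):=\alpha\psi(\alpha^{-1}x,y)$ satisfies $$\overline\psi((\alpha,x),y)=\inf_{f,t,u}\{f^Ty+t: Pf+tp+Qu+Rx-\alpha s\leq_{\mathbf K}0\}.$$
   Context: $\mathcal K$ is a fixed family of regular cones (closed, convex, pointed, with nonempty interior) in Euclidean spaces which contains $\mathbb R_+$, is closed under finite direct products, and is closed under passing to dual cones. $a\leq_{\mathbf K}b$ means $b-a\in\mathbf K$. $\mathcal X,\mathcal Y$ are nonempty convex sets which are $\mathcal K$-representable, i.e. of the form $\{x:\exists u:Ax+Bu\leq_{\mathbf K}c\}$ with $\mathbf K\in\mathcal K$. A $\mathcal K$-representation of a real-valued continuous convex-concave function $\psi$ on $\mathcal X\times\mathcal Y$ is an identity of the form displayed in the claim, with $\mathbf K\in\mathcal K$. *)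

theory Defs
  imports
    "HOL-Analysis.Abstract_Euclidean_Space"
    "HOL-Library.Extended_Real"
    "Jordan_Normal_Form.Matrix"
begin

text \<open>
  The dimensions of the cones in a family vary inside one statement, so a Euclidean space is
  \<^term>\<open>carrier_vec n :: real vec set\<close> rather than a type.
\<close>

unbundle no inner_syntax

text \<open>
  The entries of a vector beyond its dimension are unspecified, hence the truncation.
\<close>

definition vec_topology :: "nat \<Rightarrow> real vec topology" where
  "vec_topology n =
     pullback_topology (carrier_vec n) (\<lambda>v i. if i < n then v $ i else 0) (Euclidean_space n)"

definition vec_convex :: "real vec set \<Rightarrow> bool" where
  "vec_convex S \<longleftrightarrow>
     (\<forall>x\<in>S. \<forall>y\<in>S. \<forall>a\<ge>0. \<forall>b\<ge>0. a + b = 1 \<longrightarrow> a \<cdot>\<^sub>v x + b \<cdot>\<^sub>v y \<in> S)"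

definition vec_convex_on :: "real vec set \<Rightarrow> (real vec \<Rightarrow> real) \<Rightarrow> bool" where
  "vec_convex_on S g \<longleftrightarrow>
     vec_convex S \<and>
     (\<forall>x\<in>S. \<forall>y\<in>S. \<forall>a\<ge>0. \<forall>b\<ge>0. a + b = 1 \<longrightarrow>
        g (a \<cdot>\<^sub>v x + b \<cdot>\<^sub>v y) \<le> a * g x + b * g y)"

definition convex_concave_on ::
    "real vec set \<Rightarrow> real vec set \<Rightarrow> (real vec \<Rightarrow> real vec \<Rightarrow> real) \<Rightarrow> bool" where
  "convex_concave_on X Y \<psi> \<longleftrightarrow>
     (\<forall>y\<in>Y. vec_convex_on X (\<lambda>x. \<psi> x y)) \<and>
     (\<forall>x\<in>X. vec_convex_on Y (\<lambda>y. - \<psi> x y))"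

definition regular_cone :: "nat \<Rightarrow> real vec set \<Rightarrow> bool" where
  "regular_cone n K \<longleftrightarrow>
     K \<subseteq> carrier_vec n \<and>
     (\<forall>x\<in>K. \<forall>a\<ge>0. a \<cdot>\<^sub>v x \<in> K) \<and>
     vec_convex K \<and>
     closedin (vec_topology n) K \<and>
     (\<forall>x\<in>K. - x \<in> K \<longrightarrow> x = 0\<^sub>v n) \<and>
     vec_topology n interior_of K \<noteq> {}"

definition cone_le :: "real vec \<Rightarrow> real vec set \<Rightarrow> real vec \<Rightarrow> bool"
    (\<open>(_ \<preceq>\<^bsub>_\<^esub> _)\<close> [51, 0, 51] 50) where
  "a \<preceq>\<^bsub>K\<^esub> b \<longleftrightarrow> b - a \<in> K"

definition nonneg_ray :: "real vec set" where
  "nonneg_ray = {v \<in> carrier_vec 1. 0 \<le> v $ 0}"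

definition cone_prod :: "real vec set \<Rightarrow> real vec set \<Rightarrow> real vec set" where
  "cone_prod K L = {x @\<^sub>v y | x y. x \<in> K \<and> y \<in> L}"

definition dual_cone :: "nat \<Rightarrow> real vec set \<Rightarrow> real vec set" where
  "dual_cone n K = {y \<in> carrier_vec n. \<forall>x\<in>K. 0 \<le> y \<bullet> x}"

text \<open>
  Closure under binary products gives closure under all nonempty finite products;
  the empty product, the zero cone of dimension 0, is allowed but not required.
\<close>

definition cone_family :: "real vec set set \<Rightarrow> bool" where
  "cone_family \<K> \<longleftrightarrow>
     (\<forall>K\<in>\<K>. \<exists>n. regular_cone n K) \<and>
     nonneg_ray \<in> \<K> \<and>
     (\<forall>K\<in>\<K>. \<forall>L\<in>\<K>. cone_prod K L \<in> \<K>) \<and>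
     (\<forall>K\<in>\<K>. \<forall>n. regular_cone n K \<longrightarrow> dual_cone n K \<in> \<K>)"

definition representable_set :: "real vec set set \<Rightarrow> nat \<Rightarrow> real vec set \<Rightarrow> bool" where
  "representable_set \<K> n X \<longleftrightarrow>
     (\<exists>K\<in>\<K>. \<exists>k l A B c.
        regular_cone k K \<and> A \<in> carrier_mat k n \<and> B \<in> carrier_mat k l \<and> c \<in> carrier_vec k \<and>
        X = {x \<in> carrier_vec n. \<exists>u\<in>carrier_vec l. A *\<^sub>v x + B *\<^sub>v u \<preceq>\<^bsub>K\<^esub> c})"

definition perspective ::
    "(real vec \<Rightarrow> real vec \<Rightarrow> real) \<Rightarrow> real \<times> real vec \<Rightarrow> real vec \<Rightarrow> real" where
  "perspective \<psi> = (\<lambda>(\<alpha>, x) y. \<alpha> * \<psi> (inverse \<alpha> \<cdot>\<^sub>v x) y)"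

end

theory Submission
  imports Defs "HOL-Analysis.Extended_Real_Limits"
begin

text \<open>Put z = \<alpha>^{-1} x. Multiplying (f, t, u) by \<alpha> > 0 maps the feasible triples
  of the representation of \<psi> at z bijectively onto the feasible triples of the homogenized
  system at x. Indeed the slack of the system is multiplied by \<alpha>, and a cone is invariant
  under positive scaling in both directions, since \<alpha>^{-1} is also an admissible factor
  (\<open>regular_cone_smult_iff\<close>, \<open>homogenized_constraint_iff\<close>). The objective
  f^T y + t is linear in (f, t), so it is multiplied by \<alpha> as well, and a positive real factor
  passes through an infimum (\<open>INF_ereal_cmult\<close>). Hence the infimum at x is \<alpha>
  \<psi>(z, y).\<close>

lemma regular_cone_smult_iff:
  assumes "regular_cone k K" and "a > 0" and "v \<in> carrier_vec k"
  shows "a \<cdot>\<^sub>v v \<in> K \<longleftrightarrow> v \<in> K"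
proof
  assume "a \<cdot>\<^sub>v v \<in> K"
  then have "inverse a \<cdot>\<^sub>v (a \<cdot>\<^sub>v v) \<in> K"
    using assms unfolding regular_cone_def by auto
  then show "v \<in> K"
    using assms by (simp add: smult_smult_assoc)
next
  assume "v \<in> K"
  then show "a \<cdot>\<^sub>v v \<in> K"
    using assms unfolding regular_cone_def by auto
qed

text \<open>The slack on the left is exactly \<alpha> times the slack on the right. Since the
  variables on the left are written as multiples of \<alpha>, the equivalence serves both directions
  of the change of variables.\<close>

lemma homogenized_constraint_iff:
  assumes K: "regular_cone k K" and a: "\<alpha> > 0"
    and mat: "P \<in> carrier_mat k m" "p \<in> carrier_vec k" "Q \<in> carrier_mat k l"
      "R \<in> carrier_mat k n" "s \<in> carrier_vec k"
    and vec: "f \<in> carrier_vec m" "u \<in> carrier_vec l" "x \<in> carrier_vec n"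
  shows "P *\<^sub>v (\<alpha> \<cdot>\<^sub>v f) + (\<alpha> * t) \<cdot>\<^sub>v p + Q *\<^sub>v (\<alpha> \<cdot>\<^sub>v u) + R *\<^sub>v (\<alpha> \<cdot>\<^sub>v x) - \<alpha> \<cdot>\<^sub>v s \<preceq>\<^bsub>K\<^esub> 0\<^sub>v k
    \<longleftrightarrow> P *\<^sub>v f + t \<cdot>\<^sub>v p + Q *\<^sub>v u + R *\<^sub>v x \<preceq>\<^bsub>K\<^esub> s"
proof -
  have "0\<^sub>v k - (P *\<^sub>v (\<alpha> \<cdot>\<^sub>v f) + (\<alpha> * t) \<cdot>\<^sub>v p + Q *\<^sub>v (\<alpha> \<cdot>\<^sub>v u) + R *\<^sub>v (\<alpha> \<cdot>\<^sub>v x) - \<alpha> \<cdot>\<^sub>v s)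
      = \<alpha> \<cdot>\<^sub>v (s - (P *\<^sub>v f + t \<cdot>\<^sub>v p + Q *\<^sub>v u + R *\<^sub>v x))"
    \<comment> \<open>Once \<alpha> is pulled out of the three matrix products, only distributivity
      in each entry remains.\<close>
    unfolding mult_mat_vec[OF mat(1) vec(1)] mult_mat_vec[OF mat(3) vec(2)]
      mult_mat_vec[OF mat(4) vec(3)]
    using mat vec by (intro eq_vecI) (auto simp: algebra_simps)
  then show ?thesis
    unfolding cone_le_def using regular_cone_smult_iff[OF K a] mat vec by simp
qed

text \<open>Strict positivity covers empty \<open>A\<close> too: the infimum is then \<infinity>,
  which a positive factor preserves, whereas 0 * \<infinity> = 0 in \<open>ereal\<close>.\<close>

lemma INF_ereal_cmult:
  fixes g :: "'a \<Rightarrow> ereal"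
  assumes "0 < c"
  shows "(INF i\<in>A. ereal c * g i) = ereal c * (INF i\<in>A. g i)"
proof -
  have "(\<lambda>i. ereal c * g i) ` A = {ereal c * x |x. x \<in> g ` A}"
    by blast
  then show ?thesis
    using ereal_Inf_cmult[OF assms, of "\<lambda>x. x \<in> g ` A"] by simp
qed

theorem mainTheorem7:
  fixes \<K> :: "real vec set set"
    and n m k l :: nat
    and X Y K :: "real vec set"
    and \<psi> :: "real vec \<Rightarrow> real vec \<Rightarrow> real"
    and P Q R :: "real mat"
    and p s :: "real vec"
  assumes "cone_family \<K>"
    and "X \<noteq> {}" and "vec_convex X" and "representable_set \<K> n X"
    and "Y \<noteq> {}" and "vec_convex Y" and "representable_set \<K> m Y"
    and "continuous_map
           (prod_topology (subtopology (vec_topology n) X) (subtopology (vec_topology m) Y))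
           euclideanreal (\<lambda>(x, y). \<psi> x y)"
    and "convex_concave_on X Y \<psi>"
    and "K \<in> \<K>" and "regular_cone k K"
    and "P \<in> carrier_mat k m" and "p \<in> carrier_vec k" and "Q \<in> carrier_mat k l"
    and "R \<in> carrier_mat k n" and "s \<in> carrier_vec k"
    and "\<forall>x\<in>X. \<forall>y\<in>Y.
           ereal (\<psi> x y) =
           (INF (f, t, u) \<in> {(f, t, u). f \<in> carrier_vec m \<and> u \<in> carrier_vec l \<and>
                P *\<^sub>v f + t \<cdot>\<^sub>v p + Q *\<^sub>v u + R *\<^sub>v x \<preceq>\<^bsub>K\<^esub> s}.
              ereal (f \<bullet> y + t))"
  shows "\<forall>\<alpha> > 0. \<forall>x \<in> carrier_vec n. inverse \<alpha> \<cdot>\<^sub>v x \<in> X \<longrightarrow> (\<forall>y\<in>Y.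
           ereal (perspective \<psi> (\<alpha>, x) y) =
           (INF (f, t, u) \<in> {(f, t, u). f \<in> carrier_vec m \<and> u \<in> carrier_vec l \<and>
                P *\<^sub>v f + t \<cdot>\<^sub>v p + Q *\<^sub>v u + R *\<^sub>v x - \<alpha> \<cdot>\<^sub>v s \<preceq>\<^bsub>K\<^esub> 0\<^sub>v k}.
              ereal (f \<bullet> y + t)))"
proof (intro allI ballI impI)
  fix \<alpha> :: real and x y :: "real vec"
  assume \<alpha>: "0 < \<alpha>" and x: "x \<in> carrier_vec n" and xX: "inverse \<alpha> \<cdot>\<^sub>v x \<in> X" and y: "y \<in> Y"
  define z where "z = inverse \<alpha> \<cdot>\<^sub>v x"
  have z: "z \<in> carrier_vec n" and x_eq: "x = \<alpha> \<cdot>\<^sub>v z"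
    using x \<alpha> by (simp_all add: z_def smult_smult_assoc)
  \<comment> \<open>Representability places \<open>Y\<close> in dimension \<open>m\<close>; matching
    dimensions let the scalar move out of \<open>f \<bullet> y\<close> below.\<close>
  have y_dim: "y \<in> carrier_vec m"
    using assms(7) y unfolding representable_set_def by auto
  define F where "F = {(f, t, u). f \<in> carrier_vec m \<and> u \<in> carrier_vec l \<and>
    P *\<^sub>v f + t \<cdot>\<^sub>v p + Q *\<^sub>v u + R *\<^sub>v z \<preceq>\<^bsub>K\<^esub> s}"
  define G where "G = {(f, t, u). f \<in> carrier_vec m \<and> u \<in> carrier_vec l \<and>
    P *\<^sub>v f + t \<cdot>\<^sub>v p + Q *\<^sub>v u + R *\<^sub>v x - \<alpha> \<cdot>\<^sub>v s \<preceq>\<^bsub>K\<^esub> 0\<^sub>v k}"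
  define h where "h = (\<lambda>(f, t, u). (\<alpha> \<cdot>\<^sub>v f, \<alpha> * t, \<alpha> \<cdot>\<^sub>v (u :: real vec)))"
  note constraint_iff = homogenized_constraint_iff[OF assms(11) \<alpha> assms(12-16) _ _ z, folded x_eq]
  have "G = h ` F"
  proof (intro equalityI subsetI)
    fix w assume "w \<in> G"
    obtain f t u where w: "w = (f, t, u)" by (cases w)
    \<comment> \<open>The preimage under \<open>h\<close> undoes the scaling; the equivalence at
      these divided variables turns the constraint of \<open>G\<close> into that of
      \<open>F\<close>.\<close>
    define w' where "w' = (inverse \<alpha> \<cdot>\<^sub>v f, inverse \<alpha> * t, inverse \<alpha> \<cdot>\<^sub>v u)"
    have "h w' = w"
      using \<alpha> by (simp add: h_def w'_def w smult_smult_assoc mult.assoc[symmetric])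
    moreover have "w' \<in> F"
      using \<open>w \<in> G\<close> constraint_iff[of "inverse \<alpha> \<cdot>\<^sub>v f" "inverse \<alpha> \<cdot>\<^sub>v u" "inverse \<alpha> * t"] \<alpha>
      by (simp add: F_def G_def w w'_def smult_smult_assoc mult.assoc[symmetric])
    ultimately show "w \<in> h ` F" by force
  next
    fix w assume "w \<in> h ` F"
    then show "w \<in> G"
      using constraint_iff by (auto simp: F_def G_def h_def)
  qed
  have "ereal (perspective \<psi> (\<alpha>, x) y) = ereal \<alpha> * ereal (\<psi> z y)"
    by (simp add: perspective_def z_def)
  also have "ereal (\<psi> z y) = (INF (f, t, u) \<in> F. ereal (f \<bullet> y + t))"
    using assms(17) xX y unfolding F_def z_def by blast
  also have "ereal \<alpha> * \<dots> = (INF (f, t, u) \<in> F. ereal ((\<alpha> \<cdot>\<^sub>v f) \<bullet> y + \<alpha> * t))"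
    unfolding INF_ereal_cmult[OF \<alpha>, symmetric]
    using y_dim by (intro INF_cong) (auto simp: F_def algebra_simps)
  \<comment> \<open>Reindexing along \<open>h\<close>: the scaled objective on \<open>F\<close> is
    the plain objective on its image \<open>G\<close>.\<close>
  also have "\<dots> = (INF (f, t, u) \<in> G. ereal (f \<bullet> y + t))"
    unfolding \<open>G = h ` F\<close> image_image h_def by (simp add: case_prod_unfold)
  finally show "ereal (perspective \<psi> (\<alpha>, x) y) =
      (INF (f, t, u) \<in> {(f, t, u). f \<in> carrier_vec m \<and> u \<in> carrier_vec l \<and>
         P *\<^sub>v f + t \<cdot>\<^sub>v p + Q *\<^sub>v u + R *\<^sub>v x - \<alpha> \<cdot>\<^sub>v s \<preceq>\<^bsub>K\<^esub> 0\<^sub>v k}.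
       ereal (f \<bullet> y + t))"
    unfolding G_def .
qed

end
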